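(* (i) Quasi-isometries between digraphs all of whose vertices have finite out-degree extend canonically to bijective maps between their f-ends that preserve the order $\preccurlyeq$. (ii) Quasi-isometries between digraphs all of whose vertices have finite in-degree extend canonically to bijective maps between their b-ends that preserve the order $\preccurlyeq$. (iii) Quasi-isometries between locally finite digraphs extend canonically to bijective maps between their ends that preserve the order $\preccurlyeq$.
   Context: Digraphs may have loops, parallel edges and oppositely oriented edges. A directed path is a sequence $x_0\ldots x_n$ of vertices with every $x_ix_{i+1}$ an edge; its length is $n$; $d(x,y)$ is the length of a shortest directed path from $x$ to $y$, or $\infty$ if there is none. The out-degree (in-degree) of $x$ is the number of $y$ with $d(x,y)=1$ ($d(y,x)=1$); a digraph is locally finite if all in- and out-degrees are finite. A ray is a sequence $x_0x_1\ldots$ of distinct vertices with edges $x_ix_{i+1}$; an anti-ray is such a sequence with edges $x_{i+1}x_i$. For rays or anti-rays $R_1,R_2$ of a digraph $D$ write $R_1\preccurlyeq R_2$ if there are infinitely many pairwise disjoint directed paths from $R_1$ to $R_2$ in $D$. This is a quasiorder; $R_1\sim R_2$ means $R_1\preccurlyeq R_2$ and $R_2\preccurlyeq R_1$. The equivalence classes of $\sim$ on all rays and anti-rays are the ends of $D$; the classes of $\sim$ restricted to rays (anti-rays) are the f-ends (b-ends). $\preccurlyeq$ induces orders on the sets of ends, f-ends and b-ends. A map $f\colon D_1\to D_2$ (on vertex sets) is a quasi-isometry if for some $\gamma\ge1,c\ge0$: $\gamma^{-1}d(x,x')-c\le d(f(x),f(x'))\le\gamma d(x,x')+c$ for all $x,x'\in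 V(D_1)$, and for every $y\in V(D_2)$ there is $x\in V(D_1)$ with $d(f(x),y)\le c$ and $d(y,f(x))\le c$. "Extend canonically" means: the class of a ray $x_1x_2\ldots$ of $D_1$ is mapped to the class of any ray contained in the infinite directed walk obtained by concatenating directed $f(x_i)$-$f(x_{i+1})$ paths of length at most $\gamma+c$ (for $i=1,2,\ldots$) in $D_2$, and analogously for anti-rays, with directed $f(x_{i+1})$-$f(x_i)$ paths. *)

theory Defs
  imports
    "Graph_Theory.Digraph"
    "Graph_Theory.Vertex_Walk"
    "HOL-Library.Extended_Real"
begin

text \<open>
  Digraphs are the \<^locale>\<open>wf_digraph\<close>s of the Graph Theory library: vertex and arc sets are
  arbitrary, and loops and parallel arcs are allowed. Directed paths are vertex sequences, i.e.
  \<^const>\<open>vwalk\<close>s.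
\<close>

definition dpath :: "('a, 'b) pre_digraph \<Rightarrow> 'a \<Rightarrow> 'a list \<Rightarrow> 'a \<Rightarrow> bool" where
  "dpath G u p v \<longleftrightarrow> vwalk p G \<and> hd p = u \<and> last p = v"

text \<open>In \<^typ>\<open>enat\<close> a nonempty infimum is attained, and the empty one is \<open>\<infinity>\<close>.\<close>

definition ddist :: "('a, 'b) pre_digraph \<Rightarrow> 'a \<Rightarrow> 'a \<Rightarrow> enat" where
  "ddist G u v = (INF p \<in> {p. dpath G u p v}. enat (vwalk_length p))"

text \<open>Degrees count neighbours at distance 1, so loops and multiplicities of arcs are ignored.\<close>

definition finite_out_degrees :: "('a, 'b) pre_digraph \<Rightarrow> bool" where
  "finite_out_degrees G \<longleftrightarrow> (\<forall>x \<in> verts G. finite {y \<in> verts G. ddist G x y = 1})"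

definition finite_in_degrees :: "('a, 'b) pre_digraph \<Rightarrow> bool" where
  "finite_in_degrees G \<longleftrightarrow> (\<forall>x \<in> verts G. finite {y \<in> verts G. ddist G y x = 1})"

definition locally_finite_digraph :: "('a, 'b) pre_digraph \<Rightarrow> bool" where
  "locally_finite_digraph G \<longleftrightarrow> finite_out_degrees G \<and> finite_in_degrees G"

definition forward_walk :: "('a, 'b) pre_digraph \<Rightarrow> (nat \<Rightarrow> 'a) \<Rightarrow> bool" where
  "forward_walk G W \<longleftrightarrow> (\<forall>i. W i \<rightarrow>\<^bsub>G\<^esub> W (Suc i))"

definition backward_walk :: "('a, 'b) pre_digraph \<Rightarrow> (nat \<Rightarrow> 'a) \<Rightarrow> bool" where
  "backward_walk G W \<longleftrightarrow> (\<forall>i. W (Suc i) \<rightarrow>\<^bsub>G\<^esub> W i)"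

definition rays :: "('a, 'b) pre_digraph \<Rightarrow> (nat \<Rightarrow> 'a) set" where
  "rays G = {R. inj R \<and> forward_walk G R}"

definition antirays :: "('a, 'b) pre_digraph \<Rightarrow> (nat \<Rightarrow> 'a) set" where
  "antirays G = {R. inj R \<and> backward_walk G R}"

definition ray_le :: "('a, 'b) pre_digraph \<Rightarrow> (nat \<Rightarrow> 'a) \<Rightarrow> (nat \<Rightarrow> 'a) \<Rightarrow> bool" where
  "ray_le G R S \<longleftrightarrow>
     (\<exists>P. infinite P \<and> (\<forall>p \<in> P. \<exists>u \<in> range R. \<exists>v \<in> range S. dpath G u p v) \<and>
          pairwise (\<lambda>p q. disjnt (set p) (set q)) P)"

text \<open>
  In the following, \<open>A\<close> is the set of sequences under consideration: \<^term>\<open>rays G\<close> for f-ends,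
  \<^term>\<open>antirays G\<close> for b-ends, and \<^term>\<open>rays G \<union> antirays G\<close> for ends.
\<close>

definition ray_rel :: "('a, 'b) pre_digraph \<Rightarrow> (nat \<Rightarrow> 'a) set \<Rightarrow> (nat \<Rightarrow> 'a) rel" where
  "ray_rel G A = {(R, S). R \<in> A \<and> S \<in> A \<and> ray_le G R S \<and> ray_le G S R}"

definition ray_class :: "('a, 'b) pre_digraph \<Rightarrow> (nat \<Rightarrow> 'a) set \<Rightarrow> (nat \<Rightarrow> 'a) \<Rightarrow> (nat \<Rightarrow> 'a) set" where
  "ray_class G A R = ray_rel G A `` {R}"

definition ray_classes :: "('a, 'b) pre_digraph \<Rightarrow> (nat \<Rightarrow> 'a) set \<Rightarrow> (nat \<Rightarrow> 'a) set set" where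
  "ray_classes G A = A // ray_rel G A"

abbreviation f_ends :: "('a, 'b) pre_digraph \<Rightarrow> (nat \<Rightarrow> 'a) set set" where
  "f_ends G \<equiv> ray_classes G (rays G)"

abbreviation b_ends :: "('a, 'b) pre_digraph \<Rightarrow> (nat \<Rightarrow> 'a) set set" where
  "b_ends G \<equiv> ray_classes G (antirays G)"

abbreviation ends :: "('a, 'b) pre_digraph \<Rightarrow> (nat \<Rightarrow> 'a) set set" where
  "ends G \<equiv> ray_classes G (rays G \<union> antirays G)"

definition end_le :: "('a, 'b) pre_digraph \<Rightarrow> (nat \<Rightarrow> 'a) set \<Rightarrow> (nat \<Rightarrow> 'a) set \<Rightarrow> bool" where
  "end_le G \<omega> \<eta> \<longleftrightarrow> (\<exists>R \<in> \<omega>. \<exists>S \<in> \<eta>. ray_le G R S)"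

definition quasi_isometry ::
    "real \<Rightarrow> real \<Rightarrow> ('a, 'b) pre_digraph \<Rightarrow> ('c, 'd) pre_digraph \<Rightarrow> ('a \<Rightarrow> 'c) \<Rightarrow> bool" where
  "quasi_isometry \<gamma> c D1 D2 f \<longleftrightarrow>
     \<gamma> \<ge> 1 \<and> c \<ge> 0 \<and> f ` verts D1 \<subseteq> verts D2 \<and>
     (\<forall>x \<in> verts D1. \<forall>x' \<in> verts D1.
        ereal (inverse \<gamma>) * ereal_of_enat (ddist D1 x x') - ereal c
          \<le> ereal_of_enat (ddist D2 (f x) (f x')) \<and>
        ereal_of_enat (ddist D2 (f x) (f x'))
          \<le> ereal \<gamma> * ereal_of_enat (ddist D1 x x') + ereal c) \<and>
     (\<forall>y \<in> verts D2. \<exists>x \<in> verts D1.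
        ereal_of_enat (ddist D2 (f x) y) \<le> ereal c \<and>
        ereal_of_enat (ddist D2 y (f x)) \<le> ereal c)"

text \<open>
  The infinite walk \<open>W\<close> is composed of successive pieces of length at most \<open>L\<close>, the \<open>i\<close>-th one
  joining \<open>y i\<close> and \<open>y (Suc i)\<close>; \<open>s\<close> lists the positions at which the pieces are glued together
  (pieces may have length 0). The direction of the pieces is that of \<open>W\<close>: for a backward walk
  they are directed paths from \<open>y (Suc i)\<close> to \<open>y i\<close>.
\<close>

definition glued_along :: "real \<Rightarrow> (nat \<Rightarrow> 'a) \<Rightarrow> (nat \<Rightarrow> 'a) \<Rightarrow> bool" where
  "glued_along L y W \<longleftrightarrow>
     (\<exists>s :: nat \<Rightarrow> nat. s 0 = 0 \<and> (\<forall>k. \<exists>i. k \<le> s i) \<and>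
        (\<forall>i. W (s i) = y i \<and> s i \<le> s (Suc i) \<and> real (s (Suc i) - s i) \<le> L))"

text \<open>Containment as subgraphs: every edge of \<open>S\<close> is traversed by \<open>W\<close>.\<close>

definition contained_in :: "(nat \<Rightarrow> 'a) \<Rightarrow> (nat \<Rightarrow> 'a) \<Rightarrow> bool" where
  "contained_in S W \<longleftrightarrow> (\<forall>j. \<exists>k. S j = W k \<and> S (Suc j) = W (Suc k))"

text \<open>
  The map \<open>F\<close> on classes (of elements of \<open>A1\<close>, resp. \<open>A2\<close>) is the canonical extension of \<open>f\<close> on
  (anti-)rays. That the construction is possible at all (a suitable walk exists, and every
  such walk contains an (anti-)ray) is part of the definition, so that it is never vacuous.
\<close>

definition extends_on_rays ::
    "real \<Rightarrow> real \<Rightarrow> ('a, 'b) pre_digraph \<Rightarrow> ('c, 'd) pre_digraph \<Rightarrow> ('a \<Rightarrow> 'c) \<Rightarrow>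
     (nat \<Rightarrow> 'a) set \<Rightarrow> (nat \<Rightarrow> 'c) set \<Rightarrow> ((nat \<Rightarrow> 'a) set \<Rightarrow> (nat \<Rightarrow> 'c) set) \<Rightarrow> bool" where
  "extends_on_rays \<gamma> c D1 D2 f A1 A2 F \<longleftrightarrow>
     (\<forall>R \<in> rays D1.
        (\<exists>W. forward_walk D2 W \<and> glued_along (\<gamma> + c) (f \<circ> R) W) \<and>
        (\<forall>W. forward_walk D2 W \<and> glued_along (\<gamma> + c) (f \<circ> R) W \<longrightarrow>
           (\<exists>S \<in> rays D2. contained_in S W) \<and>
           (\<forall>S \<in> rays D2. contained_in S W \<longrightarrow>
              F (ray_class D1 A1 R) = ray_class D2 A2 S)))"

definition extends_on_antirays ::
    "real \<Rightarrow> real \<Rightarrow> ('a, 'b) pre_digraph \<Rightarrow> ('c, 'd) pre_digraph \<Rightarrow> ('a \<Rightarrow> 'c) \<Rightarrow>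
     (nat \<Rightarrow> 'a) set \<Rightarrow> (nat \<Rightarrow> 'c) set \<Rightarrow> ((nat \<Rightarrow> 'a) set \<Rightarrow> (nat \<Rightarrow> 'c) set) \<Rightarrow> bool" where
  "extends_on_antirays \<gamma> c D1 D2 f A1 A2 F \<longleftrightarrow>
     (\<forall>R \<in> antirays D1.
        (\<exists>W. backward_walk D2 W \<and> glued_along (\<gamma> + c) (f \<circ> R) W) \<and>
        (\<forall>W. backward_walk D2 W \<and> glued_along (\<gamma> + c) (f \<circ> R) W \<longrightarrow>
           (\<exists>S \<in> antirays D2. contained_in S W) \<and>
           (\<forall>S \<in> antirays D2. contained_in S W \<longrightarrow>
              F (ray_class D1 A1 R) = ray_class D2 A2 S)))"

definition end_order_iso ::
    "('a, 'b) pre_digraph \<Rightarrow> ('c, 'd) pre_digraph \<Rightarrow> (nat \<Rightarrow> 'a) set set \<Rightarrow> (nat \<Rightarrow> 'c) set set \<Rightarrow>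
     ((nat \<Rightarrow> 'a) set \<Rightarrow> (nat \<Rightarrow> 'c) set) \<Rightarrow> bool" where
  "end_order_iso D1 D2 E1 E2 F \<longleftrightarrow>
     bij_betw F E1 E2 \<and>
     (\<forall>\<omega> \<in> E1. \<forall>\<eta> \<in> E1. end_le D1 \<omega> \<eta> \<longleftrightarrow> end_le D2 (F \<omega>) (F \<eta>))"

end

theory Submission
  imports Defs
begin

text \<open>
  By a greedy choice of paths, \<open>R \<preceq> S\<close> holds iff every finite vertex set can be avoided by some path
  from \<open>R\<close> to \<open>S\<close> (\<open>ray_le_iff_joined_off\<close>). In this form the relation makes sense for all sequences
  of vertices, such as the image \<open>f \<circ> R\<close> of a ray, and it is transitive through those sequences along
  which one can travel while avoiding finite sets (\<open>linked\<close>, \<open>ray_le_trans\<close>).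

  A quasi-isometry \<open>f\<close> preserves and reflects this relation (\<open>quasi_isometry_ray_le_iff\<close>). Indeed, a path
  of the first digraph yields a walk of the second one by joining the images of successive vertices
  by paths of bounded length. Such a walk meets a finite set \<open>X\<close> only if the path contains one of
  the vertices whose images are reached from \<open>X\<close> in a bounded number of steps. When out-degrees are
  finite, there are only finitely many of these, and a path avoiding them all exists. The converse
  is the same argument in the opposite direction, both directions being subsumed under the
  symmetric notion of a coarse correspondence (\<open>ray_le_transfer\<close>).

  It remains to pass from \<open>f \<circ> R\<close> to a ray. A walk composed of bounded paths between successive members
  of \<open>f \<circ> R\<close> visits each vertex only finitely often, again because balls are finite. Jumping along
  last visits, one finds a ray in it, and every ray in it shares infinitely many vertices with the
  walk, hence is equivalent to \<open>f \<circ> R\<close> (\<open>glued_walk_rays\<close>). So the canonical extension of \<open>f\<close> maps the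
  class of \<open>R\<close> to the class of rays equivalent to \<open>f \<circ> R\<close> (\<open>end_map\<close>). That it is well-defined, injective
  and an order embedding follows from \<open>f\<close> preserving and reflecting the order. It is
  surjective because any ray of the second digraph is followed by a sequence in the first one,
  to which the same construction of a ray applies (\<open>quasi_isometry_rays_surj\<close>). Anti-rays are treated
  by reversing both digraphs.
\<close>

section \<open>Directed paths and distances\<close>

lemma dpath_singleton: "v \<in> verts G \<Longrightarrow> dpath G v [v] v"
  by (auto simp: dpath_def)

lemma dpath_append:
  assumes "dpath G u p v" "dpath G v q w"
  obtains r where "dpath G u r w" "set r \<subseteq> set p \<union> set q"
    "vwalk_length r = vwalk_length p + vwalk_length q"
proof
  have "joinable p q" using assms by (auto simp: dpath_def vwalk_def)
  then show "dpath G u (p \<oplus> q) w" "vwalk_length (p \<oplus> q) = vwalk_length p + vwalk_length q"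
    using assms
    by (auto simp: dpath_def vwalk_join_hd vwalk_join_last intro: vwalk_joinI_vwalk
        simp del: vwalk_length_simp)
  show "set (p \<oplus> q) \<subseteq> set p \<union> set q"
    by (auto simp: vwalk_join_def dest: list.set_sel(2)[rotated]) (metis list.set_sel(2) tl_Nil)
qed

lemma dpath_ends_in_set: "dpath G u p v \<Longrightarrow> u \<in> set p \<and> v \<in> set p"
  by (auto simp: dpath_def vwalk_def)

lemma dpath_in_verts: "dpath G u p v \<Longrightarrow> set p \<subseteq> verts G"
  by (auto simp: dpath_def vwalk_def)

lemma dpath_nth_dominates:
  assumes "dpath G u p v" "Suc i < length p"
  shows "p ! i \<rightarrow>\<^bsub>G\<^esub> p ! Suc i"
proof -
  have "vwalk p G" using assms by (simp add: dpath_def)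
  then show ?thesis using assms(2)
  proof (induction arbitrary: i rule: vwalk_induct)
    case (Cons u v es)
    then show ?case by (cases i) auto
  qed auto
qed

lemma ddist_le_enat_iff:
  "ddist G u v \<le> enat n \<longleftrightarrow> (\<exists>p. dpath G u p v \<and> vwalk_length p \<le> n)"
proof
  assume *: "ddist G u v \<le> enat n"
  show "\<exists>p. dpath G u p v \<and> vwalk_length p \<le> n"
  proof (rule ccontr)
    assume "\<not> ?thesis"
    then have "enat (Suc n) \<le> ddist G u v"
      unfolding ddist_def by (intro INF_greatest) (auto simp: not_le)
    then have "enat (Suc n) \<le> enat n" using * by (rule order_trans)
    then show False by simp
  qed
next
  assume "\<exists>p. dpath G u p v \<and> vwalk_length p \<le> n"
  then obtain p where p: "dpath G u p v" "vwalk_length p \<le> n" by blast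
  have "ddist G u v \<le> enat (vwalk_length p)"
    unfolding ddist_def using p(1) by (intro INF_lower) simp
  also have "\<dots> \<le> enat n" using p(2) by simp
  finally show "ddist G u v \<le> enat n" .
qed

lemma dpath_ddist_to_end:
  assumes "dpath G u p v" "vwalk_length p \<le> n" "w \<in> set p"
  shows "ddist G w v \<le> enat n"
proof -
  obtain q r where qr: "p = q @ w # r" using split_list[OF assms(3)] by blast
  have "dpath G w (w # r) v"
    using assms(1) vwalkI_append_r[of "w # r" q G] unfolding dpath_def qr by auto
  moreover have "vwalk_length (w # r) \<le> n" using assms(2) qr by simp
  ultimately show ?thesis unfolding ddist_le_enat_iff by blast
qed

lemma ddist_triangle:
  assumes "ddist G u v \<le> enat m" "ddist G v w \<le> enat n"
  shows "ddist G u w \<le> enat (m + n)"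
proof -
  obtain p q where "dpath G u p v" "vwalk_length p \<le> m" "dpath G v q w" "vwalk_length q \<le> n"
    using assms by (auto simp: ddist_le_enat_iff simp del: vwalk_length_simp)
  then show ?thesis
    by (elim dpath_append[of G u p v q w])
      (auto simp: ddist_le_enat_iff simp del: vwalk_length_simp intro!: exI)
qed

lemma ddist_mono: "ddist G u v \<le> enat m \<Longrightarrow> m \<le> n \<Longrightarrow> ddist G u v \<le> enat n"
  by (meson enat_ord_simps(1) order_trans)

lemma ddist_self: "v \<in> verts G \<Longrightarrow> ddist G v v \<le> enat n"
  using dpath_singleton[of v G] by (auto simp: ddist_le_enat_iff intro!: exI)

lemma ddist_le_0: "ddist G u v \<le> enat 0 \<Longrightarrow> u = v"
  by (auto simp: ddist_le_enat_iff dpath_def neq_Nil_conv vwalk_def)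

lemma ddist_in_verts: "ddist G u v \<le> enat n \<Longrightarrow> u \<in> verts G \<and> v \<in> verts G"
  by (auto simp: ddist_le_enat_iff dest: dpath_ends_in_set dpath_in_verts)

lemma dominates_in_verts:
  assumes "wf_digraph G" "u \<rightarrow>\<^bsub>G\<^esub> v" shows "u \<in> verts G" "v \<in> verts G"
  using assms wf_digraph.tail_in_verts wf_digraph.head_in_verts
  by (auto simp: arcs_ends_conv)

lemma ddist_dominates:
  assumes "wf_digraph G" "u \<rightarrow>\<^bsub>G\<^esub> v" shows "ddist G u v \<le> enat 1"
proof -
  have "dpath G u [u, v] v"
    using assms dominates_in_verts[OF assms] by (auto simp: dpath_def)
  then show ?thesis by (auto simp: ddist_le_enat_iff intro!: exI)
qed

text \<open>Out-degrees ignore loops, hence the extra element \<open>x\<close> in the set of out-neighbours.\<close>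

lemma finite_out_neighbours:
  assumes "wf_digraph G" "finite_out_degrees G"
  shows "finite {y. x \<rightarrow>\<^bsub>G\<^esub> y}"
proof (cases "x \<in> verts G")
  case True
  have "{y. x \<rightarrow>\<^bsub>G\<^esub> y} \<subseteq> insert x {y \<in> verts G. ddist G x y = 1}"
  proof
    fix y assume "y \<in> {y. x \<rightarrow>\<^bsub>G\<^esub> y}"
    then have y: "x \<rightarrow>\<^bsub>G\<^esub> y" by simp
    have "ddist G x y \<le> enat 1" by (rule ddist_dominates[OF assms(1) y])
    then have "ddist G x y = 1 \<or> ddist G x y \<le> enat 0"
      by (cases "ddist G x y") (auto simp: one_enat_def)
    then show "y \<in> insert x {y \<in> verts G. ddist G x y = 1}"
      using dominates_in_verts[OF assms(1) y] ddist_le_0[of G x y] by auto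
  qed
  moreover have "finite {y \<in> verts G. ddist G x y = 1}"
    using assms(2) True by (simp add: finite_out_degrees_def)
  ultimately show ?thesis by (meson finite_insert finite_subset)
next
  case False
  then have "{y. x \<rightarrow>\<^bsub>G\<^esub> y} = {}" using dominates_in_verts[OF assms(1)] by blast
  then show ?thesis by simp
qed

lemma finite_out_ball:
  assumes "wf_digraph G" "finite_out_degrees G"
  shows "finite {y. ddist G x y \<le> enat n}"
proof (induction n arbitrary: x)
  case 0
  have "{y. ddist G x y \<le> enat 0} \<subseteq> {x}" using ddist_le_0 by fastforce
  then show ?case by (rule finite_subset) simp
next
  case (Suc n)
  have "{y. ddist G x y \<le> enat (Suc n)} \<subseteq> insert x (\<Union>z\<in>{z. x \<rightarrow>\<^bsub>G\<^esub> z}. {y. ddist G z y \<le> enat n})"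
  proof clarify
    fix y assume "ddist G x y \<le> enat (Suc n)"
      and far: "y \<notin> (\<Union>z\<in>{z. x \<rightarrow>\<^bsub>G\<^esub> z}. {y. ddist G z y \<le> enat n})"
    then obtain p where p: "dpath G x p y" "vwalk_length p \<le> Suc n"
      by (auto simp: ddist_le_enat_iff simp del: vwalk_length_simp)
    then consider "p = [x]" | z q where "p = x # z # q"
      by (auto simp: dpath_def vwalk_def) (metis list.exhaust list.sel(1))
    then show "y = x"
    proof cases
      case 1 then show ?thesis using p by (simp add: dpath_def)
    next
      case 2
      then have "x \<rightarrow>\<^bsub>G\<^esub> z" "dpath G z (z # q) y" "vwalk_length (z # q) \<le> n"
        using p by (auto simp: dpath_def vwalk_def)
      then have "x \<rightarrow>\<^bsub>G\<^esub> z" "ddist G z y \<le> enat n" unfolding ddist_le_enat_iff by blast+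
      then show ?thesis using far by blast
    qed
  qed
  then show ?case
    by (rule finite_subset) (use Suc finite_out_neighbours[OF assms] in auto)
qed

section \<open>Reversing a digraph\<close>

text \<open>
  Reversal exchanges rays and anti-rays, in-degrees and out-degrees, and turns \<^const>\<open>ray_le\<close>
  around. Everything on anti-rays is obtained from the corresponding result on rays in this way.
\<close>

definition converse_digraph :: "('a, 'b) pre_digraph \<Rightarrow> ('a, 'b) pre_digraph" where
  "converse_digraph G = G\<lparr>tail := head G, head := tail G\<rparr>"

lemma verts_converse [simp]: "verts (converse_digraph G) = verts G"
  by (simp add: converse_digraph_def)

lemma arcs_ends_converse [simp]: "arcs_ends (converse_digraph G) = (arcs_ends G)\<inverse>"
  by (auto simp: converse_digraph_def arcs_ends_conv)

lemma wf_digraph_converse: "wf_digraph G \<Longrightarrow> wf_digraph (converse_digraph G)"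
  by (auto simp: wf_digraph_def converse_digraph_def)

lemma converse_converse [simp]: "converse_digraph (converse_digraph G) = G"
  by (simp add: converse_digraph_def)

lemma dpath_rev: "dpath G u p v \<Longrightarrow> dpath (converse_digraph G) v (rev p) u"
  by (auto simp: dpath_def vwalk_def set_vwalk_arcs_rev hd_rev last_rev)

lemma ddist_converse [simp]: "ddist (converse_digraph G) u v = ddist G v u"
proof -
  have le: "ddist (converse_digraph H) x y \<le> ddist H y x" for H :: "('a, 'b) pre_digraph" and x y
    unfolding ddist_def by (rule INF_mono) (auto dest: dpath_rev intro!: exI bexI)
  show ?thesis using le[of G u v] le[of "converse_digraph G" v u] by simp
qed

lemma finite_out_degrees_converse [simp]:
  "finite_out_degrees (converse_digraph G) \<longleftrightarrow> finite_in_degrees G"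
  by (simp add: finite_out_degrees_def finite_in_degrees_def)

lemma forward_walk_converse [simp]: "forward_walk (converse_digraph G) W \<longleftrightarrow> backward_walk G W"
  by (simp add: forward_walk_def backward_walk_def)

lemma rays_converse [simp]: "rays (converse_digraph G) = antirays G"
  by (simp add: rays_def antirays_def)

lemma ray_le_converse [simp]: "ray_le (converse_digraph G) R S \<longleftrightarrow> ray_le G S R"
proof -
  have imp: "ray_le (converse_digraph H) S R" if le: "ray_le H R S"
    for H :: "('a, 'b) pre_digraph" and R S
  proof -
    obtain P where P: "infinite P" "\<forall>p\<in>P. \<exists>u\<in>range R. \<exists>v\<in>range S. dpath H u p v"
      "pairwise (\<lambda>p q. disjnt (set p) (set q)) P"
      using le unfolding ray_le_def by blast
    have "infinite (rev ` P)" using P(1) by (simp add: finite_image_iff inj_on_def)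
    then show ?thesis unfolding ray_le_def
      using P(2,3) by (intro exI[of _ "rev ` P"])
       (auto 0 4 simp: pairwise_def intro: dpath_rev)
  qed
  show ?thesis using imp[of "converse_digraph G" R S] imp[of G S R] by auto
qed

section \<open>The quasi-order on sequences\<close>

definition joined_off :: "('a, 'b) pre_digraph \<Rightarrow> 'a set \<Rightarrow> 'a \<Rightarrow> 'a \<Rightarrow> bool" where
  "joined_off G X u v \<longleftrightarrow> (\<exists>p. dpath G u p v \<and> set p \<inter> X = {})"

lemma joined_off_trans:
  assumes "joined_off G X u v" "joined_off G X v w"
  shows "joined_off G X u w"
proof -
  obtain p q where pq: "dpath G u p v" "set p \<inter> X = {}" "dpath G v q w" "set q \<inter> X = {}"
    using assms unfolding joined_off_def by blast
  obtain r where "dpath G u r w" "set r \<subseteq> set p \<union> set q"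
    using dpath_append[OF pq(1,3)] .
  then show ?thesis using pq(2,4) unfolding joined_off_def by blast
qed

lemma joined_off_antimono: "joined_off G Y u v \<Longrightarrow> X \<subseteq> Y \<Longrightarrow> joined_off G X u v"
  unfolding joined_off_def by blast

lemma joined_off_endpoints: "joined_off G X u v \<Longrightarrow> u \<in> verts G - X \<and> v \<in> verts G - X"
  using dpath_ends_in_set dpath_in_verts unfolding joined_off_def by fastforce

lemma joined_off_refl: "v \<in> verts G - X \<Longrightarrow> joined_off G X v v"
  using dpath_singleton unfolding joined_off_def by fastforce

lemma joined_off_converse: "joined_off (converse_digraph G) X u v \<longleftrightarrow> joined_off G X v u"
  using dpath_rev[of G v _ u] dpath_rev[of "converse_digraph G" u _ v] 
  unfolding joined_off_def by (metis converse_converse set_rev)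

text \<open>
  No finite set separates \<open>R\<close> from \<open>S\<close>: of infinitely many disjoint paths, one misses any given
  finite set; conversely, paths are collected greedily, each one avoiding its predecessors.
\<close>

lemma ray_le_iff_joined_off:
  "ray_le G R S \<longleftrightarrow> (\<forall>X. finite X \<longrightarrow> (\<exists>i j. joined_off G X (R i) (S j)))"
proof
  assume "ray_le G R S"
  then obtain P where P: "infinite P" "\<forall>p\<in>P. \<exists>u\<in>range R. \<exists>v\<in>range S. dpath G u p v"
    "pairwise (\<lambda>p q. disjnt (set p) (set q)) P"
    unfolding ray_le_def by blast
  show "\<forall>X. finite X \<longrightarrow> (\<exists>i j. joined_off G X (R i) (S j))"
  proof (intro allI impI, rule ccontr)
    fix X :: "'a set"
    assume X: "finite X" and "\<nexists>i j. joined_off G X (R i) (S j)"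
    then have "\<forall>p\<in>P. \<exists>x. x \<in> set p \<inter> X" using P(2) unfolding joined_off_def by blast
    then obtain h where h: "\<And>p. p \<in> P \<Longrightarrow> h p \<in> set p \<inter> X" by metis
    have "inj_on h P"
    proof (rule inj_onI, rule ccontr)
      fix p q assume "p \<in> P" "q \<in> P" "h p = h q" "p \<noteq> q"
      then show False using P(3) h[of p] h[of q] by (auto simp: pairwise_def disjnt_def)
    qed
    moreover have "h ` P \<subseteq> X" using h by auto
    ultimately show False using X P(1) by (meson finite_imageD finite_subset)
  qed
next
  assume R: "\<forall>X. finite X \<longrightarrow> (\<exists>i j. joined_off G X (R i) (S j))"
  define good where "good h n p \<longleftrightarrow> (\<exists>u\<in>range R. \<exists>v\<in>range S. dpath G u p v) \<and>
      set p \<inter> (\<Union>k<n. set (h k)) = {}" for h :: "nat \<Rightarrow> 'a list" and n :: nat and p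
  have "\<exists>h. \<forall>n. good h n (h n)"
  proof (rule dependent_wellorder_choice)
    fix h :: "nat \<Rightarrow> 'a list" and n :: nat
    have "finite (\<Union>k<n. set (h k))" by simp
    then obtain i j where "joined_off G (\<Union>k<n. set (h k)) (R i) (S j)" using R by blast
    then show "\<exists>p. good h n p" unfolding good_def joined_off_def by blast
  qed (simp add: good_def)
  then obtain h where h: "\<And>n. good h n (h n)" by blast
  have disj: "disjnt (set (h m)) (set (h n))" if "m \<noteq> n" for m n
  proof (cases "m < n")
    case True then show ?thesis using h[of n] by (auto simp: good_def disjnt_def)
  next
    case False then show ?thesis using h[of m] that by (force simp: good_def disjnt_def)
  qed
  have "h n \<noteq> []" for n using h[of n] by (auto simp: good_def dpath_def vwalk_def)
  then have "h m \<noteq> h n" if "m \<noteq> n" for m n using disj[OF that] by (auto simp: disjnt_def)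
  then have "inj h" unfolding inj_def by blast
  then have "infinite (range h)" by (rule range_inj_infinite)
  moreover have "\<forall>p\<in>range h. \<exists>u\<in>range R. \<exists>v\<in>range S. dpath G u p v"
    using h unfolding good_def by blast
  moreover have "pairwise (\<lambda>p q. disjnt (set p) (set q)) (range h)"
    using disj unfolding pairwise_def by (metis rangeE)
  ultimately show "ray_le G R S" unfolding ray_le_def by blast
qed

lemma ray_le_mono:
  assumes "ray_le G R S" "range R \<subseteq> range R'" "range S \<subseteq> range S'"
  shows "ray_le G R' S'"
  using assms unfolding ray_le_def by (meson subsetD)

lemma ray_le_if_infinite_meet:
  assumes "infinite (range R \<inter> range S \<inter> verts G)"
  shows "ray_le G R S"
  unfolding ray_le_iff_joined_off
proof (intro allI impI)
  fix X :: "'a set" assume "finite X"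
  then obtain v where v: "v \<in> range R \<inter> range S \<inter> verts G" "v \<notin> X"
    using assms by (meson finite_subset subsetI)
  obtain i j where "v = R i" "v = S j" using v(1) by blast
  moreover have "joined_off G X v v" using v by (simp add: joined_off_refl)
  ultimately show "\<exists>i j. joined_off G X (R i) (S j)" by metis
qed

text \<open>
  The relation \<^const>\<open>ray_le\<close> makes sense for arbitrary sequences, but it need not be transitive
  unless one can travel along the middle sequence while avoiding a given finite set. This is
  possible along rays, but also along walks visiting each vertex finitely often and along images of
  rays under quasi-isometries, and so it is made a notion of its own. Travelling is in one
  direction only: forward for rays, backward for anti-rays.
\<close>

definition linked :: "('a, 'b) pre_digraph \<Rightarrow> (nat \<Rightarrow> 'a) \<Rightarrow> bool" where
  "linked G Q \<longleftrightarrow> (\<forall>X. finite X \<longrightarrow> (\<exists>N.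
     (\<forall>i\<ge>N. \<forall>j\<ge>i. joined_off G X (Q i) (Q j)) \<or> (\<forall>i\<ge>N. \<forall>j\<ge>i. joined_off G X (Q j) (Q i))))"

lemma linked_converse [simp]: "linked (converse_digraph G) Q \<longleftrightarrow> linked G Q"
  unfolding linked_def joined_off_converse by (simp add: disj_commute)

text \<open>
  Given a finite set, let \<open>Q\<close> be forward linked, say. After leaving \<open>R\<close> towards a late
  vertex \<open>Q i\<close>, depart from \<open>Q\<close> towards \<open>S\<close> at an even later vertex \<open>Q j\<close>.
  When \<open>Q\<close> is linked backwards, the departure is chosen before the arrival.
\<close>

lemma ray_le_trans:
  assumes RQ: "ray_le G R Q" and QS: "ray_le G Q S" and "linked G Q"
  shows "ray_le G R S"
  unfolding ray_le_iff_joined_off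
proof (intro allI impI)
  fix X :: "'a set" assume X: "finite X"
  have late: "\<exists>i j. k \<le> j \<and> joined_off G X (R i) (Q j)"
    and late': "\<exists>i j. k \<le> i \<and> joined_off G X (Q i) (S j)" for k
  proof -
    let ?Y = "X \<union> Q ` {..<k}"
    have Y: "finite ?Y" using X by simp
    have out: "k \<le> i" if "Q i \<notin> ?Y" for i using that by (meson UnI2 image_eqI lessThan_iff not_le)
    obtain i j where ij: "joined_off G ?Y (R i) (Q j)"
      using RQ Y unfolding ray_le_iff_joined_off by blast
    have "k \<le> j" using joined_off_endpoints[OF ij] by (intro out) simp
    then show "\<exists>i j. k \<le> j \<and> joined_off G X (R i) (Q j)"
      using joined_off_antimono[OF ij, of X] by blast
    obtain i j where ij: "joined_off G ?Y (Q i) (S j)"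
      using QS Y unfolding ray_le_iff_joined_off by blast
    have "k \<le> i" using joined_off_endpoints[OF ij] by (intro out) simp
    then show "\<exists>i j. k \<le> i \<and> joined_off G X (Q i) (S j)"
      using joined_off_antimono[OF ij, of X] by blast
  qed
  obtain N where "(\<forall>i\<ge>N. \<forall>j\<ge>i. joined_off G X (Q i) (Q j)) \<or> 
      (\<forall>i\<ge>N. \<forall>j\<ge>i. joined_off G X (Q j) (Q i))"
    using assms(3) X unfolding linked_def by blast
  then show "\<exists>i j. joined_off G X (R i) (S j)"
  proof
    assume fwd: "\<forall>i\<ge>N. \<forall>j\<ge>i. joined_off G X (Q i) (Q j)"
    obtain a i where i: "N \<le> i" "joined_off G X (R a) (Q i)" using late by blast
    obtain j b where "i \<le> j" "joined_off G X (Q j) (S b)" using late' by blast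
    then show ?thesis using i fwd by (blast intro: joined_off_trans)
  next
    assume bwd: "\<forall>i\<ge>N. \<forall>j\<ge>i. joined_off G X (Q j) (Q i)"
    obtain i b where i: "N \<le> i" "joined_off G X (Q i) (S b)" using late' by blast
    obtain a j where "i \<le> j" "joined_off G X (R a) (Q j)" using late by blast
    then show ?thesis using i bwd by (blast intro: joined_off_trans)
  qed
qed

lemma linked_infinite_range:
  assumes "linked G Q" shows "infinite (range Q \<inter> verts G)"
proof
  assume "finite (range Q \<inter> verts G)"
  then obtain N where "joined_off G (range Q \<inter> verts G) (Q N) (Q N)"
    using assms unfolding linked_def by (metis order_refl)
  then show False using joined_off_endpoints[of G _ "Q N" "Q N"] by blast
qed

lemma linked_subsequence:
  assumes Q: "linked G Q" and "mono s" and unbounded: "\<And>k. \<exists>i. k \<le> s i"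
  shows "linked G (Q \<circ> s)"
  unfolding linked_def
proof (intro allI impI)
  fix X :: "'a set" assume "finite X"
  then obtain N where N: "(\<forall>i\<ge>N. \<forall>j\<ge>i. joined_off G X (Q i) (Q j)) \<or> 
      (\<forall>i\<ge>N. \<forall>j\<ge>i. joined_off G X (Q j) (Q i))"
    using Q unfolding linked_def by blast
  obtain M where "N \<le> s M" using unbounded by blast
  then have "N \<le> s i" "s i \<le> s j" if "M \<le> i" "i \<le> j" for i j
    using that monoD[OF \<open>mono s\<close>] by (meson order_trans)+
  with N show "\<exists>N. (\<forall>i\<ge>N. \<forall>j\<ge>i. joined_off G X ((Q \<circ> s) i) ((Q \<circ> s) j)) \<or> 
      (\<forall>i\<ge>N. \<forall>j\<ge>i. joined_off G X ((Q \<circ> s) j) ((Q \<circ> s) i))"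
    unfolding o_def by (intro exI[of _ M]) blast
qed

definition finite_to_one :: "(nat \<Rightarrow> 'a) \<Rightarrow> bool" where
  "finite_to_one Q \<longleftrightarrow> (\<forall>v. finite {i. Q i = v})"

lemma finite_to_one_inj: "inj Q \<Longrightarrow> finite_to_one Q"
proof -
  assume "inj Q"
  have "finite (Q -` {v})" for v by (rule finite_vimageI) (use \<open>inj Q\<close> in auto)
  then show ?thesis by (simp add: finite_to_one_def vimage_def)
qed

lemma finite_to_one_vimage:
  assumes "finite_to_one Q" "finite X" shows "finite {i. Q i \<in> X}"
proof -
  have "{i. Q i \<in> X} = (\<Union>v\<in>X. {i. Q i = v})" by blast
  then show ?thesis using assms by (simp add: finite_to_one_def)
qed

lemma forward_walk_in_verts: "wf_digraph G \<Longrightarrow> forward_walk G W \<Longrightarrow> W i \<in> verts G"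
  using dominates_in_verts unfolding forward_walk_def by metis

lemma forward_walk_linked:
  assumes "wf_digraph G" "forward_walk G W" "finite_to_one W"
  shows "linked G W"
  unfolding linked_def
proof (intro allI impI)
  fix X :: "'a set" assume "finite X"
  then have "finite {i. W i \<in> X}" by (rule finite_to_one_vimage[OF assms(3)])
  then obtain N where N: "\<And>i. N \<le> i \<Longrightarrow> W i \<notin> X"
    using finite_nat_set_iff_bounded by (metis mem_Collect_eq not_le)
  have "joined_off G X (W i) (W j)" if "N \<le> i" "i \<le> j" for i j
    using that(2)
  proof (induction j rule: dec_induct)
    case base
    then show ?case
      using N[OF that(1)] forward_walk_in_verts[OF assms(1,2)] by (simp add: joined_off_refl)
  next
    case (step j)
    have "dpath G (W j) [W j, W (Suc j)] (W (Suc j))"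
      using assms(2) forward_walk_in_verts[OF assms(1,2)] by (auto simp: dpath_def vwalk_def forward_walk_def)
    moreover have "set [W j, W (Suc j)] \<inter> X = {}" using N that(1) step.hyps by auto
    ultimately have "joined_off G X (W j) (W (Suc j))" unfolding joined_off_def by blast
    with step.IH show ?case by (rule joined_off_trans)
  qed
  then show "\<exists>N. (\<forall>i\<ge>N. \<forall>j\<ge>i. joined_off G X (W i) (W j)) \<or> 
      (\<forall>i\<ge>N. \<forall>j\<ge>i. joined_off G X (W j) (W i))" by blast
qed

lemma ray_linked: "wf_digraph G \<Longrightarrow> R \<in> rays G \<Longrightarrow> linked G R"
  by (simp add: forward_walk_linked finite_to_one_inj rays_def)

lemma ray_le_refl: "linked G R \<Longrightarrow> ray_le G R R"
  by (simp add: ray_le_if_infinite_meet linked_infinite_range)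

section \<open>Rays in infinite walks\<close>

text \<open>
  Jump from the last visit of a vertex to its successor on the walk, then to the last visit of
  that vertex, and so on. The positions of last visits increase strictly, and so the vertices
  visited are distinct.
\<close>

lemma forward_walk_contains_ray:
  assumes "forward_walk G W" "finite_to_one W"
  obtains S where "S \<in> rays G" "contained_in S W"
proof -
  define visit where "visit v = Max {k. W k = v}" for v
  have visit: "W (visit (W k)) = W k" "k \<le> visit (W k)" for k
  proof -
    have fin: "finite {j. W j = W k}" using assms(2) by (simp add: finite_to_one_def)
    then have "visit (W k) \<in> {j. W j = W k}" unfolding visit_def by (intro Max_in) auto
    then show "W (visit (W k)) = W k" by simp
    show "k \<le> visit (W k)" unfolding visit_def using fin by (intro Max_ge) auto
  qed
  define t where "t = rec_nat (visit (W 0)) (\<lambda>_ k. visit (W (Suc k)))"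
  have t_Suc: "t (Suc n) = visit (W (Suc (t n)))" for n by (simp add: t_def)
  have t_visit: "t n = visit (W (t n))" for n
    by (cases n) (simp_all add: t_Suc visit(1), simp add: t_def visit(1))
  have "strict_mono t"
    unfolding strict_mono_Suc_iff t_Suc using visit(2) Suc_le_lessD by blast
  have "inj (W \<circ> t)"
  proof (rule injI)
    fix m n assume "(W \<circ> t) m = (W \<circ> t) n"
    then have "t m = t n" using t_visit[of m] t_visit[of n] by simp
    then show "m = n" using strict_mono_eq[OF \<open>strict_mono t\<close>] by blast
  qed
  moreover have edge: "(W \<circ> t) (Suc n) = W (Suc (t n))" for n by (simp add: t_Suc visit(1))
  then have "forward_walk G (W \<circ> t)"
    using assms(1) unfolding forward_walk_def edge by simp
  ultimately have "W \<circ> t \<in> rays G" by (simp add: rays_def)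
  moreover have "contained_in (W \<circ> t) W" unfolding contained_in_def using edge by auto
  ultimately show thesis by (rule that)
qed

text \<open>
  The contained sequence need not run through \<open>W\<close> in order: it suffices that it shares
  infinitely many vertices with \<open>W\<close>.
\<close>

lemma ray_le_contained:
  assumes "contained_in S W" "linked G S"
  shows "ray_le G S W" "ray_le G W S"
proof -
  have "range S \<subseteq> range W" using assms(1) unfolding contained_in_def by (metis image_subsetI rangeI)
  then have "range S \<inter> range W \<inter> verts G = range S \<inter> verts G" "range W \<inter> range S \<inter> verts G = range S \<inter> verts G"
    by blast+
  then show "ray_le G S W" "ray_le G W S"
    using linked_infinite_range[OF assms(2)] by (simp_all add: ray_le_if_infinite_meet)
qed

lemma glued_along_switch_points:
  assumes "glued_along L y W"
  obtains s where "s 0 = 0" "mono s" "\<And>k. \<exists>i. k \<le> s i" "y = W \<circ> s"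
    "\<And>i. real (s (Suc i) - s i) \<le> L"
proof -
  obtain s where s: "s 0 = 0" "\<forall>k. \<exists>i. k \<le> s i"
    "\<forall>i. W (s i) = y i \<and> s i \<le> s (Suc i) \<and> real (s (Suc i) - s i) \<le> L"
    using assms unfolding glued_along_def by blast
  show thesis by (rule that[of s]) (use s in \<open>auto simp: mono_iff_le_Suc simp del: of_nat_diff\<close>)
qed

lemma switch_point_interval:
  fixes s :: "nat \<Rightarrow> nat"
  assumes "s 0 = 0" "\<exists>i. k < s i"
  obtains i where "s i \<le> k" "k < s (Suc i)"
proof -
  define m where "m = (LEAST i. k < s i)"
  have m: "k < s m" unfolding m_def using assms(2) by (rule LeastI_ex)
  with assms(1) obtain i where i: "m = Suc i" by (cases m) auto
  then have "\<not> k < s i" using not_less_Least[of i "\<lambda>i. k < s i"] by (simp add: m_def)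
  with m i show thesis by (intro that[of i]) auto
qed

lemma forward_walk_ddist:
  assumes "wf_digraph G" "forward_walk G W" "i \<le> j"
  shows "ddist G (W i) (W j) \<le> enat (j - i)"
  using assms(3)
proof (induction j rule: dec_induct)
  case base
  show ?case using forward_walk_in_verts[OF assms(1,2)] by (intro ddist_self)
next
  case (step j)
  have "ddist G (W j) (W (Suc j)) \<le> enat 1"
    using assms(2) by (intro ddist_dominates assms(1)) (simp add: forward_walk_def)
  from ddist_triangle[OF step.IH this] show ?case using step.hyps by (simp add: Suc_diff_le)
qed

text \<open>
  A vertex visited infinitely often would reach infinitely many of the vertices \<open>y i\<close> within
  the length of a piece.
\<close>

lemma glued_walk_finite_to_one:
  assumes "wf_digraph G" "finite_out_degrees G"
    and "forward_walk G W" "glued_along L y W" "finite_to_one y"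
  shows "finite_to_one W"
  unfolding finite_to_one_def
proof
  fix v
  obtain s where s: "s 0 = 0" "mono s" "\<And>k. \<exists>i. k \<le> s i" "y = W \<circ> s"
    "\<And>i. real (s (Suc i) - s i) \<le> L"
    using glued_along_switch_points[OF assms(4)] by blast
  define M where "M = nat \<lfloor>L\<rfloor>"
  have M: "s (Suc i) - s i \<le> M" for i using s(5)[of i] by (simp add: M_def le_nat_floor)
  define I where "I = {i. y i \<in> {w. ddist G v w \<le> enat M}}"
  have "finite I" unfolding I_def
    using finite_to_one_vimage[OF assms(5)] finite_out_ball[OF assms(1,2)] by blast
  moreover have "{k. W k = v} \<subseteq> (\<Union>i\<in>I. {..s i})"
  proof
    fix k assume k: "k \<in> {k. W k = v}"
    obtain i where i: "s i \<le> k" "k < s (Suc i)"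
      using switch_point_interval[of s k] s(1,3) Suc_le_eq by metis
    have "ddist G (W k) (W (s (Suc i))) \<le> enat (s (Suc i) - k)"
      using i by (intro forward_walk_ddist assms) simp
    then have "ddist G v (y (Suc i)) \<le> enat M"
      using k s(4) i M[of i] by (auto elim!: ddist_mono)
    then have "Suc i \<in> I" by (simp add: I_def)
    then show "k \<in> (\<Union>i\<in>I. {..s i})" using i by (auto intro!: bexI[of _ "Suc i"])
  qed
  ultimately show "finite {k. W k = v}" by (meson finite_UN finite_atMost finite_subset)
qed

text \<open>
  Choose paths of length at most \<open>M\<close> between successive members of \<open>y\<close>. Since \<open>y\<close> is finite-to-one,
  infinitely many of them have positive length, so that their concatenation is infinite.
\<close>

lemma glued_walk_exists:
  assumes y: "finite_to_one y" and near: "\<And>i. ddist G (y i) (y (Suc i)) \<le> enat M"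
    and "real M \<le> L"
  obtains W where "forward_walk G W" "glued_along L y W"
proof -
  have "\<exists>p. \<forall>i. dpath G (y i) (p i) (y (Suc i)) \<and> vwalk_length (p i) \<le> M"
    using near unfolding ddist_le_enat_iff by (intro choice) blast
  then obtain p where p: "\<And>i. dpath G (y i) (p i) (y (Suc i))" "\<And>i. length (p i) - 1 \<le> M"
    by auto
  have p_nonempty: "p i \<noteq> []" for i using p(1)[of i] by (auto simp: dpath_def vwalk_def)
  have p_first: "p i ! 0 = y i" and p_last: "p i ! (length (p i) - 1) = y (Suc i)" for i
    using p(1)[of i] p_nonempty[of i] by (simp_all add: dpath_def hd_conv_nth last_conv_nth)
  define s where "s n = (\<Sum>i<n. length (p i) - 1)" for n
  have s_0: "s 0 = 0" and s_Suc: "s (Suc i) = s i + (length (p i) - 1)" for i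
    by (simp_all add: s_def)
  have "mono s" by (simp add: mono_iff_le_Suc s_Suc)
  have stationary: "y j = y i" if "i \<le> j" "s j = s i" for i j
    using that
  proof (induction j rule: dec_induct)
    case (step j)
    have "s i \<le> s j" "s j \<le> s (Suc j)" using monoD[OF \<open>mono s\<close>] step.hyps by auto
    then show ?case using step p_first[of j] p_last[of j] by (simp add: s_Suc)
  qed simp
  have unbounded: "\<exists>i. k \<le> s i" for k
  proof (induction k)
    case (Suc k)
    then obtain i where i: "k \<le> s i" by blast
    have "\<exists>j\<ge>i. s j \<noteq> s i"
    proof (rule ccontr)
      assume "\<not> ?thesis"
      then have "{i..} \<subseteq> {j. y j = y i}" using stationary by auto
      then show False using y infinite_Ici[of i] unfolding finite_to_one_def
        by (meson finite_subset)
    qed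
    then obtain j where "i \<le> j" "s j \<noteq> s i" by blast
    then have "Suc k \<le> s j" using i monoD[OF \<open>mono s\<close>, of i j] by simp
    then show ?case by blast
  qed simp
  have "\<exists>i. s i \<le> k \<and> k < s (Suc i)" for k
    using switch_point_interval[of s k] s_0 unbounded[of "Suc k"] Suc_le_eq by metis
  then obtain piece where piece: "\<And>k. s (piece k) \<le> k" "\<And>k. k < s (Suc (piece k))"
    by metis
  define W where "W k = p (piece k) ! (k - s (piece k))" for k
  \<comment> \<open>At the end of a piece the walk is given by some later piece, after skipping trivial ones.\<close>
  have W: "W k = p i ! (k - s i)" if k: "s i \<le> k" "k \<le> s (Suc i)" for i k
  proof -
    have "\<not> Suc (piece k) \<le> i"
      using monoD[OF \<open>mono s\<close>, of "Suc (piece k)" i] piece(2)[of k] k by auto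
    then consider "piece k = i" | "Suc i \<le> piece k" by linarith
    then show ?thesis
    proof cases
      case 1 then show ?thesis by (simp add: W_def)
    next
      case 2
      then have "k = s (piece k)" "k = s (Suc i)"
        using monoD[OF \<open>mono s\<close>, of "Suc i" "piece k"] piece(1)[of k] k by auto
      moreover from this have "y (piece k) = y (Suc i)" using stationary[OF 2] by simp
      ultimately show ?thesis
        using p_first[of "piece k"] p_last[of i] by (simp add: W_def s_Suc)
    qed
  qed
  have "forward_walk G W" unfolding forward_walk_def
  proof
    fix k
    let ?i = "piece k"
    have "W k = p ?i ! (k - s ?i)" "W (Suc k) = p ?i ! (Suc k - s ?i)"
      using piece[of k] by (auto intro!: W)
    moreover have "Suc k - s ?i = Suc (k - s ?i)" "Suc (k - s ?i) < length (p ?i)"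
      using piece[of k] by (auto simp: s_Suc)
    ultimately show "W k \<rightarrow>\<^bsub>G\<^esub> W (Suc k)" using dpath_nth_dominates[OF p(1)] by simp
  qed
  moreover have "glued_along L y W" unfolding glued_along_def
  proof (intro exI[of _ s] conjI allI)
    fix i
    show "W (s i) = y i" using W[of i "s i"] p_first by (simp add: s_Suc)
    show "s i \<le> s (Suc i)" by (simp add: s_Suc)
    show "real (s (Suc i) - s i) \<le> L"
      using p(2)[of i] assms(3) by (simp add: s_Suc) 
  qed (use s_0 unbounded in auto)
  ultimately show thesis by (rule that)
qed

text \<open>
  Rays contained in walks glued along \<open>y\<close> are equivalent to one another because they are all
  equivalent to \<open>y\<close>, which is a subsequence of each of these walks.
\<close>

lemma glued_walk_rays:
  assumes G: "wf_digraph G" "finite_out_degrees G"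
    and W: "forward_walk G W" "glued_along L y W" and y: "finite_to_one y"
  shows "linked G y" "\<exists>S \<in> rays G. contained_in S W"
    "\<And>S. S \<in> rays G \<Longrightarrow> contained_in S W \<Longrightarrow> ray_le G S y \<and> ray_le G y S"
proof -
  have fin: "finite_to_one W" using glued_walk_finite_to_one[OF G W y] .
  then have link: "linked G W" using forward_walk_linked G(1) W(1) by blast
  obtain s where s: "mono s" "\<And>k. \<exists>i. k \<le> s i" "y = W \<circ> s"
    using glued_along_switch_points[OF W(2)] by blast
  show y_link: "linked G y" using linked_subsequence[OF link s(1,2)] s(3) by simp
  show "\<exists>S \<in> rays G. contained_in S W" using forward_walk_contains_ray[OF W(1) fin] by blast
  have "range y \<subseteq> range W" using s(3) by auto
  then have "ray_le G W y" "ray_le G y W"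
    using ray_le_mono[OF ray_le_refl[OF y_link]] by auto
  then show "ray_le G S y \<and> ray_le G y S" if "S \<in> rays G" "contained_in S W" for S
    using ray_le_contained[OF that(2) ray_linked[OF G(1) that(1)]] link
    by (blast intro: ray_le_trans)
qed

section \<open>Coarse correspondences\<close>

text \<open>
  Relating each vertex to all vertices near its image turns a quasi-isometry into a relation that
  treats the two digraphs alike. It takes the place of a quasi-inverse: every statement about a
  coarse correspondence can be applied in the opposite direction. Bounds for distances at most one
  are enough: distance 0 controls the vertices corresponding to one and the same vertex, distance
  1 the endpoints of an edge.
\<close>

locale coarse_correspondence =
  fixes G :: "('a, 'b) pre_digraph" and H :: "('c, 'd) pre_digraph"
    and corr :: "'a \<Rightarrow> 'c \<Rightarrow> bool" and K :: nat
  assumes wf_left: "wf_digraph G" and wf_right: "wf_digraph H"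
    and total_left: "x \<in> verts G \<Longrightarrow> \<exists>y. corr x y"
    and total_right: "y \<in> verts H \<Longrightarrow> \<exists>x. corr x y"
    and ddist_right: "corr x y \<Longrightarrow> corr x' y' \<Longrightarrow> ddist G x x' \<le> enat 1 \<Longrightarrow> ddist H y y' \<le> enat K"
    and ddist_left: "corr x y \<Longrightarrow> corr x' y' \<Longrightarrow> ddist H y y' \<le> enat 1 \<Longrightarrow> ddist G x x' \<le> enat K"
    and corr_verts: "corr x y \<Longrightarrow> x \<in> verts G \<and> y \<in> verts H"
begin

lemma flip: "coarse_correspondence H G (\<lambda>y x. corr x y) K"
  by (rule coarse_correspondence.intro)
    (fact wf_left wf_right total_right total_left ddist_left ddist_right
      | use corr_verts in blast)+

lemma finite_fibre:
  assumes "finite_out_degrees G" shows "finite {x. corr x y}"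
proof (cases "\<exists>x. corr x y")
  case True
  then obtain x where x: "corr x y" by blast
  have "ddist H y y \<le> enat 1" using corr_verts[OF x] by (intro ddist_self) simp
  then have "{x'. corr x' y} \<subseteq> {x'. ddist G x x' \<le> enat K}" using ddist_left x by blast
  then show ?thesis using finite_out_ball[OF wf_left assms] by (rule finite_subset)
qed simp

text \<open>
  The path from \<open>y\<close> to \<open>y'\<close> is a concatenation of paths of length at most \<open>K\<close> between vertices
  corresponding to successive vertices of \<open>p\<close>; hence the last conjunct.
\<close>

lemma transfer_dpath:
  assumes "vwalk p G" "corr (hd p) y" "corr (last p) y'"
  shows "\<exists>q. dpath H y q y' \<and> (\<forall>w\<in>set q. \<exists>x\<in>set p. \<exists>z. corr x z \<and> ddist H w z \<le> enat K)"
  using assms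
proof (induction arbitrary: y rule: vwalk_induct)
  case (Base u)
  have "ddist G u u \<le> enat 1" using Base(1) by (intro ddist_self)
  then have "ddist H y y' \<le> enat K" using ddist_right Base by simp
  then obtain q where q: "dpath H y q y'" "vwalk_length q \<le> K"
    unfolding ddist_le_enat_iff by blast
  have "ddist H w y' \<le> enat K" if "w \<in> set q" for w
    using dpath_ddist_to_end[OF q that] .
  then show ?case using q(1) Base.prems(2) by auto
next
  case (Cons u v es)
  have "v \<in> verts G" using dominates_in_verts(2)[OF wf_left Cons.hyps] .
  then obtain z where z: "corr v z" using total_left by blast
  obtain r where r: "dpath H z r y'"
    "\<forall>w\<in>set r. \<exists>x\<in>set (v # es). \<exists>z. corr x z \<and> ddist H w z \<le> enat K"
    using Cons.IH[of z] z Cons.prems(2) by auto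
  have "ddist H y z \<le> enat K"
    using ddist_right[of u y v z] Cons.prems(1) z ddist_dominates[OF wf_left Cons.hyps] by simp
  then obtain q where q: "dpath H y q z" "vwalk_length q \<le> K"
    unfolding ddist_le_enat_iff by blast
  have near: "ddist H w z \<le> enat K" if "w \<in> set q" for w
    using dpath_ddist_to_end[OF q that] .
  obtain qr where qr: "dpath H y qr y'" "set qr \<subseteq> set q \<union> set r"
    using dpath_append[OF q(1) r(1)] .
  have "\<exists>x\<in>set (u # v # es). \<exists>z. corr x z \<and> ddist H w z \<le> enat K" if "w \<in> set qr" for w
  proof (cases "w \<in> set q")
    case True then show ?thesis using near z by auto
  next
    case False then show ?thesis using qr(2) that r(2) by auto
  qed
  then show ?case using qr(1) by blast
qed

text \<open>
  Given a finite set \<open>X\<close> to be avoided in \<open>H\<close>, only finitely many vertices of \<open>G\<close> correspond to a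
  vertex that can be reached from \<open>X\<close> within \<open>K\<close> steps. A path of \<open>G\<close> avoiding these vertices is
  transferred to a path avoiding \<open>X\<close>.
\<close>

lemma ray_le_transfer:
  assumes "finite_out_degrees G" "finite_out_degrees H"
    and le: "ray_le G R S"
    and R: "\<And>i. corr (R i) (R' i)" and S: "\<And>i. corr (S i) (S' i)"
  shows "ray_le H R' S'"
  unfolding ray_le_iff_joined_off
proof (intro allI impI)
  fix X :: "'c set" assume X: "finite X"
  define Y where "Y = (\<Union>w\<in>X. \<Union>z\<in>{z. ddist H w z \<le> enat K}. {x. corr x z})"
  have "finite Y" unfolding Y_def
    using X finite_out_ball[OF wf_right assms(2)] finite_fibre[OF assms(1)] by blast
  then obtain i j p where p: "dpath G (R i) p (S j)" "set p \<inter> Y = {}"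
    using le unfolding ray_le_iff_joined_off joined_off_def by blast
  obtain q where q: "dpath H (R' i) q (S' j)"
    "\<forall>w\<in>set q. \<exists>x\<in>set p. \<exists>z. corr x z \<and> ddist H w z \<le> enat K"
    using transfer_dpath[of p "R' i" "S' j"] p(1) R S by (auto simp: dpath_def)
  have "set q \<inter> X = {}" using q(2) p(2) unfolding Y_def by blast
  then show "\<exists>i j. joined_off H X (R' i) (S' j)" using q(1) unfolding joined_off_def by blast
qed

lemma finite_to_one_transfer:
  assumes "finite_out_degrees G" "finite_to_one R" "\<And>i. corr (R i) (R' i)"
  shows "finite_to_one R'"
  unfolding finite_to_one_def
proof
  fix y
  have "finite {i. R i \<in> {x. corr x y}}"
    using finite_to_one_vimage[OF assms(2) finite_fibre[OF assms(1)]] .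
  then show "finite {i. R' i = y}"
    by (rule rev_finite_subset) (use assms(3) in auto)
qed

text \<open>
  A sequence in \<open>H\<close> following a ray of \<open>G\<close> is equivalent to a ray of \<open>H\<close>, found in
  the walk obtained by joining successive members of the sequence.
\<close>

lemma ray_follows:
  assumes fin: "finite_out_degrees G" "finite_out_degrees H"
    and R: "R \<in> rays G" and y: "\<And>i. corr (R i) (y i)"
  shows "linked H y" "\<exists>S \<in> rays H. ray_le H S y \<and> ray_le H y S"
proof -
  have inj: "inj R" and walk: "\<And>i. R i \<rightarrow>\<^bsub>G\<^esub> R (Suc i)"
    using R by (auto simp: rays_def forward_walk_def)
  have y_fin: "finite_to_one y" 
    using finite_to_one_transfer[OF fin(1) finite_to_one_inj[OF inj] y] .
  have "ddist H (y i) (y (Suc i)) \<le> enat K" for i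
    using ddist_right[OF y y] ddist_dominates[OF wf_left walk] .
  then obtain W where W: "forward_walk H W" "glued_along (real K) y W"
    using glued_walk_exists[OF y_fin _ order_refl] by blast
  note * = glued_walk_rays[OF wf_right fin(2) W y_fin]
  show "linked H y" "\<exists>S \<in> rays H. ray_le H S y \<and> ray_le H y S" using * by blast+
qed

end

section \<open>Quasi-isometries\<close>

lemma quasi_isometry_upper:
  assumes "quasi_isometry \<gamma> c D1 D2 f" "x \<in> verts D1" "x' \<in> verts D1" "ddist D1 x x' \<le> enat n"
  shows "ddist D2 (f x) (f x') \<le> enat (nat \<lfloor>\<gamma> * n + c\<rfloor>)"
proof -
  have g: "\<gamma> \<ge> 1" using assms(1) by (simp add: quasi_isometry_def)
  have "ereal_of_enat (ddist D2 (f x) (f x')) \<le> ereal \<gamma> * ereal_of_enat (ddist D1 x x') + ereal c"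
    using assms(1-3) unfolding quasi_isometry_def by blast
  also have "\<dots> \<le> ereal \<gamma> * ereal_of_enat (enat n) + ereal c"
    using assms(4) g by (intro add_right_mono ereal_mult_left_mono) (simp_all only: ereal_of_enat_le_iff, simp)
  also have "\<dots> = ereal (\<gamma> * n + c)" by simp
  finally show ?thesis
    by (cases "ddist D2 (f x) (f x')") (auto simp: le_nat_floor)
qed

lemma quasi_isometry_lower:
  assumes "quasi_isometry \<gamma> c D1 D2 f" "x \<in> verts D1" "x' \<in> verts D1" 
    "ddist D2 (f x) (f x') \<le> enat n"
  shows "ddist D1 x x' \<le> enat (nat \<lfloor>\<gamma> * (n + c)\<rfloor>)"
proof -
  have g: "\<gamma> \<ge> 1" using assms(1) by (simp add: quasi_isometry_def)
  have "ereal (inverse \<gamma>) * ereal_of_enat (ddist D1 x x') - ereal c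
      \<le> ereal_of_enat (ddist D2 (f x) (f x'))"
    using assms(1-3) unfolding quasi_isometry_def by blast
  also have "\<dots> \<le> ereal n" using assms(4) by (metis ereal_of_enat_le_iff ereal_of_enat_simps(1))
  finally have *: "ereal (inverse \<gamma>) * ereal_of_enat (ddist D1 x x') - ereal c \<le> ereal n" .
  show ?thesis
  proof (cases "ddist D1 x x'")
    case (enat d)
    then have "inverse \<gamma> * d \<le> n + c" using * by simp
    then have "d \<le> \<gamma> * (n + c)" using g by (simp add: field_simps)
    then show ?thesis using enat by (simp add: le_nat_floor)
  next
    case infinity
    then show ?thesis using * g by simp
  qed
qed

lemma quasi_isometry_converse:
  assumes "quasi_isometry \<gamma> c D1 D2 f"
  shows "quasi_isometry \<gamma> c (converse_digraph D1) (converse_digraph D2) f"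
  using assms unfolding quasi_isometry_def by (auto 0 3)

text \<open>
  Distances in \<open>D2\<close> between vertices near \<open>f x\<close> and \<open>f x'\<close> differ from the one between \<open>f x\<close> and
  \<open>f x'\<close> by at most two detours of length \<open>C\<close>, one at each end.
\<close>

lemma quasi_isometry_correspondence:
  assumes wf: "wf_digraph D1" "wf_digraph D2" and qi: "quasi_isometry \<gamma> c D1 D2 f"
  obtains corr K where "coarse_correspondence D1 D2 corr K" "\<And>x. x \<in> verts D1 \<Longrightarrow> corr x (f x)"
proof -
  define C where "C = nat \<lfloor>c\<rfloor>"
  define K1 where "K1 = nat \<lfloor>\<gamma> * real 1 + c\<rfloor>"
  define K2 where "K2 = nat \<lfloor>\<gamma> * (real (C + 1 + C) + c)\<rfloor>"
  define K where "K = max (C + K1 + C) K2"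
  define corr where "corr x y \<longleftrightarrow> x \<in> verts D1 \<and> ddist D2 (f x) y \<le> enat C \<and> ddist D2 y (f x) \<le> enat C"
    for x y
  have f: "f x \<in> verts D2" if "x \<in> verts D1" for x
    using qi that unfolding quasi_isometry_def by blast
  have self: "corr x (f x)" if "x \<in> verts D1" for x
    using that ddist_self[OF f[OF that]] by (simp add: corr_def)
  have "coarse_correspondence D1 D2 corr K"
  proof (rule coarse_correspondence.intro)
    show "wf_digraph D1" "wf_digraph D2" by (fact wf)+
    show "\<exists>y. corr x y" if "x \<in> verts D1" for x using self that by blast
    show "\<exists>x. corr x y" if y: "y \<in> verts D2" for y
    proof -
      have floor: "e \<le> enat C" if "ereal_of_enat e \<le> ereal c" for e
        using that by (cases e) (auto simp: C_def le_nat_floor)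
      obtain x where "x \<in> verts D1" "ereal_of_enat (ddist D2 (f x) y) \<le> ereal c"
        "ereal_of_enat (ddist D2 y (f x)) \<le> ereal c"
        using qi y unfolding quasi_isometry_def by blast
      then show ?thesis using floor unfolding corr_def by blast
    qed
    show "x \<in> verts D1 \<and> y \<in> verts D2" if "corr x y" for x y
      using that ddist_in_verts[of D2 y "f x" C] by (simp add: corr_def)
    fix x y x' y' assume xy: "corr x y" "corr x' y'"
    show "ddist D2 y y' \<le> enat K" if "ddist D1 x x' \<le> enat 1"
    proof -
      have "ddist D2 (f x) (f x') \<le> enat K1"
        unfolding K1_def by (rule quasi_isometry_upper[OF qi _ _ that]) (use xy corr_def in auto)
      then have "ddist D2 y y' \<le> enat (C + K1 + C)"
        using xy unfolding corr_def by (blast intro: ddist_triangle)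
      then show ?thesis by (rule ddist_mono) (simp add: K_def)
    qed
    show "ddist D1 x x' \<le> enat K" if "ddist D2 y y' \<le> enat 1"
    proof -
      have "ddist D2 (f x) (f x') \<le> enat (C + 1 + C)"
        using xy that unfolding corr_def by (blast intro: ddist_triangle)
      then have "ddist D1 x x' \<le> enat K2"
        unfolding K2_def by (rule quasi_isometry_lower[OF qi, rotated 2]) (use xy corr_def in auto)
      then show ?thesis by (rule ddist_mono) (simp add: K_def)
    qed
  qed
  then show thesis using self by (rule that)
qed

section \<open>Ends\<close>

abbreviation ray_equiv :: "('a, 'b) pre_digraph \<Rightarrow> (nat \<Rightarrow> 'a) \<Rightarrow> (nat \<Rightarrow> 'a) \<Rightarrow> bool" where
  "ray_equiv G R S \<equiv> ray_le G R S \<and> ray_le G S R"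

lemma mem_ray_class: "S \<in> ray_class G A R \<longleftrightarrow> R \<in> A \<and> S \<in> A \<and> ray_equiv G R S"
  by (simp add: ray_class_def ray_rel_def)

lemma ray_classes_eq_image: "ray_classes G A = ray_class G A ` A"
  by (auto simp: ray_classes_def ray_class_def quotient_def)

lemma self_mem_ray_class: "linked G R \<Longrightarrow> R \<in> A \<Longrightarrow> R \<in> ray_class G A R"
  by (simp add: mem_ray_class ray_le_refl)

lemma ray_class_eq_iff:
  assumes "\<And>R. R \<in> A \<Longrightarrow> linked G R" "R \<in> A" "S \<in> A"
  shows "ray_class G A R = ray_class G A S \<longleftrightarrow> ray_equiv G R S"
proof
  assume "ray_class G A R = ray_class G A S"
  then have "S \<in> ray_class G A R" using self_mem_ray_class assms by blast
  then show "ray_equiv G R S" by (simp add: mem_ray_class)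
next
  assume "ray_equiv G R S"
  then show "ray_class G A R = ray_class G A S"
    using assms unfolding set_eq_iff mem_ray_class by (meson ray_le_trans)
qed

lemma end_le_ray_class:
  assumes "\<And>R. R \<in> A \<Longrightarrow> linked G R" "R \<in> A" "S \<in> A"
  shows "end_le G (ray_class G A R) (ray_class G A S) \<longleftrightarrow> ray_le G R S"
proof
  assume "end_le G (ray_class G A R) (ray_class G A S)"
  then obtain R' S' where "R' \<in> ray_class G A R" "S' \<in> ray_class G A S" "ray_le G R' S'"
    unfolding end_le_def by blast
  then show "ray_le G R S" using assms(1) unfolding mem_ray_class by (meson ray_le_trans)
next
  assume "ray_le G R S"
  then show "end_le G (ray_class G A R) (ray_class G A S)"
    using self_mem_ray_class assms unfolding end_le_def by blast
qed

text \<open>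
  The image of a ray need not be a walk, but it is a sequence that can be compared with rays.
  Describing the map on ends by this comparison makes it independent of the choice of
  representatives and of glued walks.
\<close>

definition end_map ::
    "('c, 'd) pre_digraph \<Rightarrow> (nat \<Rightarrow> 'c) set \<Rightarrow> ('a \<Rightarrow> 'c) \<Rightarrow> (nat \<Rightarrow> 'a) set \<Rightarrow> (nat \<Rightarrow> 'c) set" where
  "end_map H B f \<omega> = {T \<in> B. \<exists>R \<in> \<omega>. ray_equiv H T (f \<circ> R)}"

text \<open>
  Once these properties of \<open>f\<close> are established, the isomorphism between the ordered sets of ends is a
  matter of quasi-orders alone. The parameters \<open>A\<close> and \<open>B\<close> make the argument apply to f-ends, b-ends
  and ends alike.
\<close>

locale end_comparison =
  fixes G :: "('a, 'b) pre_digraph" and H :: "('c, 'd) pre_digraph"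
    and A :: "(nat \<Rightarrow> 'a) set" and B :: "(nat \<Rightarrow> 'c) set" and f :: "'a \<Rightarrow> 'c"
  assumes linked_source: "R \<in> A \<Longrightarrow> linked G R"
    and linked_target: "T \<in> B \<Longrightarrow> linked H T"
    and linked_image: "R \<in> A \<Longrightarrow> linked H (f \<circ> R)"
    and order_iff: "R \<in> A \<Longrightarrow> S \<in> A \<Longrightarrow> ray_le H (f \<circ> R) (f \<circ> S) \<longleftrightarrow> ray_le G R S"
    and into: "R \<in> A \<Longrightarrow> \<exists>T \<in> B. ray_equiv H T (f \<circ> R)"
    and onto: "T \<in> B \<Longrightarrow> \<exists>R \<in> A. ray_equiv H T (f \<circ> R)"
begin

lemma end_map_ray_class:
  assumes R: "R \<in> A" and T: "T \<in> B" "ray_equiv H T (f \<circ> R)"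
  shows "end_map H B f (ray_class G A R) = ray_class H B T"
proof (rule set_eqI)
  fix T'
  have "T' \<in> end_map H B f (ray_class G A R) \<longleftrightarrow>
      T' \<in> B \<and> (\<exists>R'\<in>A. ray_equiv H (f \<circ> R) (f \<circ> R') \<and> ray_equiv H T' (f \<circ> R'))"
    using order_iff R by (auto simp: end_map_def mem_ray_class)
  also have "\<dots> \<longleftrightarrow> T' \<in> B \<and> ray_equiv H T' (f \<circ> R)"
    using linked_image R ray_le_refl[OF linked_image[OF R]] by (meson ray_le_trans)
  also have "\<dots> \<longleftrightarrow> T' \<in> ray_class H B T"
    using T linked_target[OF T(1)] linked_image[OF R] by (auto simp: mem_ray_class intro: ray_le_trans)
  finally show "T' \<in> end_map H B f (ray_class G A R) \<longleftrightarrow> T' \<in> ray_class H B T" .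
qed

lemma end_map_order_iso:
  "end_order_iso G H (ray_classes G A) (ray_classes H B) (end_map H B f)"
proof -
  obtain h where h: "\<And>R. R \<in> A \<Longrightarrow> h R \<in> B" "\<And>R. R \<in> A \<Longrightarrow> ray_equiv H (h R) (f \<circ> R)"
    using into by metis
  have F: "end_map H B f (ray_class G A R) = ray_class H B (h R)" if "R \<in> A" for R
    using end_map_ray_class[OF that h(1)[OF that] h(2)[OF that]] .
  have le: "ray_le H (h R) (h S) \<longleftrightarrow> ray_le G R S" if "R \<in> A" "S \<in> A" for R S
  proof -
    have "ray_le H (h R) (h S) \<longleftrightarrow> ray_le H (f \<circ> R) (f \<circ> S)"
      using h(2)[OF that(1)] h(2)[OF that(2)] linked_image[OF that(1)] linked_image[OF that(2)]
        linked_target[OF h(1)[OF that(1)]] linked_target[OF h(1)[OF that(2)]] by (blast intro: ray_le_trans)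
    then show ?thesis using order_iff that by simp
  qed
  have "inj_on (end_map H B f) (ray_classes G A)"
    unfolding ray_classes_eq_image
  proof (rule inj_onI, clarify)
    fix R S assume RS: "R \<in> A" "S \<in> A"
      "end_map H B f (ray_class G A R) = end_map H B f (ray_class G A S)"
    then have "ray_equiv H (h R) (h S)" using F ray_class_eq_iff[OF linked_target] h(1) by metis
    then show "ray_class G A R = ray_class G A S"
      using le RS ray_class_eq_iff[OF linked_source] by blast
  qed
  moreover have "end_map H B f ` ray_classes G A = ray_classes H B"
  proof
    show "end_map H B f ` ray_classes G A \<subseteq> ray_classes H B"
      using F h(1) by (auto simp: ray_classes_eq_image)
    show "ray_classes H B \<subseteq> end_map H B f ` ray_classes G A"
    proof
      fix \<eta> assume "\<eta> \<in> ray_classes H B"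
      then obtain T where T: "T \<in> B" "\<eta> = ray_class H B T" by (auto simp: ray_classes_eq_image)
      obtain R where R: "R \<in> A" "ray_equiv H T (f \<circ> R)" using onto T(1) by blast
      then have "\<eta> = end_map H B f (ray_class G A R)"
        using end_map_ray_class[OF R(1) T(1) R(2)] T(2) by simp
      then show "\<eta> \<in> end_map H B f ` ray_classes G A" using R(1) by (auto simp: ray_classes_eq_image)
    qed
  qed
  moreover have "end_le G \<omega> \<eta> \<longleftrightarrow> end_le H (end_map H B f \<omega>) (end_map H B f \<eta>)"
    if "\<omega> \<in> ray_classes G A" "\<eta> \<in> ray_classes G A" for \<omega> \<eta>
  proof -
    obtain R S where "R \<in> A" "S \<in> A" "\<omega> = ray_class G A R" "\<eta> = ray_class G A S"
      using \<open>\<omega> \<in> ray_classes G A\<close> \<open>\<eta> \<in> ray_classes G A\<close> by (auto simp: ray_classes_eq_image)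
    then show ?thesis using end_le_ray_class[OF linked_source] end_le_ray_class[OF linked_target] F h(1) le by simp
  qed
  ultimately show ?thesis unfolding end_order_iso_def bij_betw_def by blast
qed

end

lemma end_comparison_converse [simp]:
  "end_comparison (converse_digraph G) (converse_digraph H) A B f \<longleftrightarrow> end_comparison G H A B f"
  by (auto simp: end_comparison_def conj_commute)

lemma end_map_converse [simp]: "end_map (converse_digraph H) B f = end_map H B f"
  by (simp add: end_map_def fun_eq_iff conj_commute)

lemma ray_class_converse [simp]: "ray_class (converse_digraph G) A = ray_class G A"
  by (auto simp: mem_ray_class fun_eq_iff set_eq_iff)

lemma extends_on_rays_converse [simp]:
  "extends_on_rays \<gamma> c (converse_digraph D1) (converse_digraph D2) f A B F \<longleftrightarrow>
     extends_on_antirays \<gamma> c D1 D2 f A B F"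
  by (simp add: extends_on_rays_def extends_on_antirays_def)

section \<open>Quasi-isometries and rays\<close>

lemma ray_in_verts: "wf_digraph G \<Longrightarrow> R \<in> rays G \<Longrightarrow> R i \<in> verts G"
  using forward_walk_in_verts by (auto simp: rays_def)

lemma antiray_in_verts: "wf_digraph G \<Longrightarrow> R \<in> antirays G \<Longrightarrow> R i \<in> verts G"
  using ray_in_verts[of "converse_digraph G" R i] by (simp add: wf_digraph_converse)

text \<open>
  The sequences of vertices \<open>R\<close> and \<open>S\<close> are arbitrary, so that rays can be compared with anti-rays.
\<close>

lemma quasi_isometry_ray_le_iff:
  assumes "wf_digraph D1" "wf_digraph D2" "quasi_isometry \<gamma> c D1 D2 f"
    and fin: "finite_out_degrees D1" "finite_out_degrees D2"
    and verts: "\<And>i. R i \<in> verts D1" "\<And>i. S i \<in> verts D1"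
  shows "ray_le D2 (f \<circ> R) (f \<circ> S) \<longleftrightarrow> ray_le D1 R S"
proof -
  obtain corr K where corr: "coarse_correspondence D1 D2 corr K"
    "\<And>x. x \<in> verts D1 \<Longrightarrow> corr x (f x)"
    using quasi_isometry_correspondence[OF assms(1-3)] by blast
  have R: "\<And>i. corr (R i) ((f \<circ> R) i)" and S: "\<And>i. corr (S i) ((f \<circ> S) i)"
    using corr(2) verts by auto
  note transfer = coarse_correspondence.ray_le_transfer
  show ?thesis
    using transfer[OF corr(1) fin, of R S "f \<circ> R" "f \<circ> S"]
      transfer[OF coarse_correspondence.flip[OF corr(1)] fin(2,1), of "f \<circ> R" "f \<circ> S" R S] R S
    by blast
qed

text \<open>
  The image of a ray is finite-to-one: the vertices of a fibre of \<open>f\<close> are at bounded distance from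
  one another, so that the fibre is finite. The results on glued walks therefore apply to it.
\<close>

lemma quasi_isometry_rays:
  assumes wf: "wf_digraph D1" "wf_digraph D2" and qi: "quasi_isometry \<gamma> c D1 D2 f"
    and fin: "finite_out_degrees D1" "finite_out_degrees D2" and R: "R \<in> rays D1"
  shows "linked D2 (f \<circ> R)" "\<exists>T \<in> rays D2. ray_equiv D2 T (f \<circ> R)"
    "\<exists>W. forward_walk D2 W \<and> glued_along (\<gamma> + c) (f \<circ> R) W"
    "\<And>W. forward_walk D2 W \<Longrightarrow> glued_along (\<gamma> + c) (f \<circ> R) W \<Longrightarrow> \<exists>S \<in> rays D2. contained_in S W"
    "\<And>W S. forward_walk D2 W \<Longrightarrow> glued_along (\<gamma> + c) (f \<circ> R) W \<Longrightarrow> S \<in> rays D2 \<Longrightarrow>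
       contained_in S W \<Longrightarrow> ray_equiv D2 S (f \<circ> R)"
proof -
  obtain corr K where corr: "coarse_correspondence D1 D2 corr K"
    "\<And>x. x \<in> verts D1 \<Longrightarrow> corr x (f x)"
    using quasi_isometry_correspondence[OF wf qi] by blast
  have corr_R: "corr (R i) ((f \<circ> R) i)" for i using corr(2) ray_in_verts[OF wf(1) R] by simp
  have "inj R" and walk: "\<And>i. R i \<rightarrow>\<^bsub>D1\<^esub> R (Suc i)"
    using R by (auto simp: rays_def forward_walk_def)
  have y: "finite_to_one (f \<circ> R)"
    using coarse_correspondence.finite_to_one_transfer
      [OF corr(1) fin(1) finite_to_one_inj[OF \<open>inj R\<close>] corr_R] .
  show "linked D2 (f \<circ> R)" "\<exists>T \<in> rays D2. ray_equiv D2 T (f \<circ> R)"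
    using coarse_correspondence.ray_follows[OF corr(1) fin R corr_R] by blast+
  have "ddist D2 ((f \<circ> R) i) ((f \<circ> R) (Suc i)) \<le> enat (nat \<lfloor>\<gamma> + c\<rfloor>)" for i
    using quasi_isometry_upper[OF qi _ _ ddist_dominates[OF wf(1) walk]] ray_in_verts[OF wf(1) R]
    by simp
  moreover have "real (nat \<lfloor>\<gamma> + c\<rfloor>) \<le> \<gamma> + c"
    using qi by (simp add: quasi_isometry_def)
  ultimately show "\<exists>W. forward_walk D2 W \<and> glued_along (\<gamma> + c) (f \<circ> R) W"
    using glued_walk_exists[OF y] by metis
  fix W assume W: "forward_walk D2 W" "glued_along (\<gamma> + c) (f \<circ> R) W"
  note * = glued_walk_rays[OF wf(2) fin(2) W y]
  show "\<exists>S \<in> rays D2. contained_in S W" by (rule *(2))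
  show "ray_equiv D2 S (f \<circ> R)" if "S \<in> rays D2" "contained_in S W" for S by (rule *(3)[OF that])
qed

text \<open>
  A ray \<open>T\<close> of the target is followed by some sequence \<open>y\<close> of vertices of the source, which
  is equivalent to a ray \<open>R\<close>. The equivalence of \<open>R\<close> and \<open>y\<close> is transferred back to one of \<open>f \<circ> R\<close> and
  \<open>T\<close>.
\<close>

lemma quasi_isometry_rays_surj:
  assumes wf: "wf_digraph D1" "wf_digraph D2" and qi: "quasi_isometry \<gamma> c D1 D2 f"
    and fin: "finite_out_degrees D1" "finite_out_degrees D2" and T: "T \<in> rays D2"
  shows "\<exists>R \<in> rays D1. ray_equiv D2 T (f \<circ> R)"
proof -
  obtain corr K where corr: "coarse_correspondence D1 D2 corr K"
    "\<And>x. x \<in> verts D1 \<Longrightarrow> corr x (f x)"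
    using quasi_isometry_correspondence[OF wf qi] by blast
  note transfer = coarse_correspondence.ray_le_transfer[OF corr(1) fin]
  have "\<exists>y. \<forall>i. corr (y i) (T i)"
    using coarse_correspondence.total_right[OF corr(1) ray_in_verts[OF wf(2) T]]
    by (intro choice) blast
  then obtain y where y: "\<And>i. corr (y i) (T i)" by blast
  obtain R where R: "R \<in> rays D1" "ray_equiv D1 R y"
    using coarse_correspondence.ray_follows(2)[OF coarse_correspondence.flip[OF corr(1)] fin(2,1) T y]
    by blast
  have "corr (R i) ((f \<circ> R) i)" for i using corr(2) ray_in_verts[OF wf(1) R(1)] by simp
  then have "ray_equiv D2 T (f \<circ> R)" using R(2) y transfer by blast
  then show ?thesis using R(1) by blast
qed

lemma quasi_isometry_compares_rays:
  assumes "wf_digraph D1" "wf_digraph D2" "quasi_isometry \<gamma> c D1 D2 f"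
    "finite_out_degrees D1" "finite_out_degrees D2"
  shows "end_comparison D1 D2 (rays D1) (rays D2) f"
  by (rule end_comparison.intro)
    (use assms in \<open>auto intro: ray_linked quasi_isometry_rays(1) quasi_isometry_rays(2)
      quasi_isometry_rays_surj simp: quasi_isometry_ray_le_iff ray_in_verts\<close>)

lemma quasi_isometry_compares_antirays:
  assumes "wf_digraph D1" "wf_digraph D2" "quasi_isometry \<gamma> c D1 D2 f"
    "finite_in_degrees D1" "finite_in_degrees D2"
  shows "end_comparison D1 D2 (antirays D1) (antirays D2) f"
  using quasi_isometry_compares_rays[of "converse_digraph D1" "converse_digraph D2" \<gamma> c f] assms
  by (simp add: wf_digraph_converse quasi_isometry_converse)

lemma end_comparison_Un:
  assumes "end_comparison G H A B f" "end_comparison G H A' B' f"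
    and "\<And>R S. R \<in> A \<union> A' \<Longrightarrow> S \<in> A \<union> A' \<Longrightarrow> ray_le H (f \<circ> R) (f \<circ> S) \<longleftrightarrow> ray_le G R S"
  shows "end_comparison G H (A \<union> A') (B \<union> B') f"
  using assms unfolding end_comparison_def by (auto 0 4)

lemma end_map_extends_on_rays:
  assumes "wf_digraph D1" "wf_digraph D2" "quasi_isometry \<gamma> c D1 D2 f"
    "finite_out_degrees D1" "finite_out_degrees D2"
    and "end_comparison D1 D2 A B f" "rays D1 \<subseteq> A" "rays D2 \<subseteq> B"
  shows "extends_on_rays \<gamma> c D1 D2 f A B (end_map D2 B f)"
  unfolding extends_on_rays_def
proof (intro ballI conjI allI impI; (elim conjE)?)
  fix R assume "R \<in> rays D1"
  note R = quasi_isometry_rays[OF assms(1-5) this] 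
  show "\<exists>W. forward_walk D2 W \<and> glued_along (\<gamma> + c) (f \<circ> R) W" by (rule R(3))
  fix W assume W: "forward_walk D2 W" "glued_along (\<gamma> + c) (f \<circ> R) W"
  show "\<exists>S \<in> rays D2. contained_in S W" by (rule R(4)[OF W])
  fix S assume "S \<in> rays D2" "contained_in S W"
  then show "end_map D2 B f (ray_class D1 A R) = ray_class D2 B S"
    using end_comparison.end_map_ray_class[OF assms(6)] R(5)[OF W] \<open>R \<in> rays D1\<close> assms(7,8) by blast
qed

lemma end_map_extends_on_antirays:
  assumes "wf_digraph D1" "wf_digraph D2" "quasi_isometry \<gamma> c D1 D2 f"
    "finite_in_degrees D1" "finite_in_degrees D2"
    and "end_comparison D1 D2 A B f" "antirays D1 \<subseteq> A" "antirays D2 \<subseteq> B"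
  shows "extends_on_antirays \<gamma> c D1 D2 f A B (end_map D2 B f)"
  using end_map_extends_on_rays[of "converse_digraph D1" "converse_digraph D2" \<gamma> c f A B] assms
  by (simp add: wf_digraph_converse quasi_isometry_converse)

theorem theorem6p2:
  fixes D1 :: "('a, 'b) pre_digraph" and D2 :: "('c, 'd) pre_digraph"
    and f :: "'a \<Rightarrow> 'c" and \<gamma> c :: real
  assumes "wf_digraph D1" and "wf_digraph D2"
    and "quasi_isometry \<gamma> c D1 D2 f"
  shows
    "(finite_out_degrees D1 \<and> finite_out_degrees D2 \<longrightarrow>
        (\<exists>F. extends_on_rays \<gamma> c D1 D2 f (rays D1) (rays D2) F \<and>
             end_order_iso D1 D2 (f_ends D1) (f_ends D2) F)) \<and>
     (finite_in_degrees D1 \<and> finite_in_degrees D2 \<longrightarrow>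
        (\<exists>F. extends_on_antirays \<gamma> c D1 D2 f (antirays D1) (antirays D2) F \<and>
             end_order_iso D1 D2 (b_ends D1) (b_ends D2) F)) \<and>
     (locally_finite_digraph D1 \<and> locally_finite_digraph D2 \<longrightarrow>
        (\<exists>F. extends_on_rays \<gamma> c D1 D2 f (rays D1 \<union> antirays D1) (rays D2 \<union> antirays D2) F \<and>
             extends_on_antirays \<gamma> c D1 D2 f (rays D1 \<union> antirays D1) (rays D2 \<union> antirays D2) F \<and>
             end_order_iso D1 D2 (ends D1) (ends D2) F))"
proof (intro conjI impI; elim conjE)
  note wf_qi = assms
  show "\<exists>F. extends_on_rays \<gamma> c D1 D2 f (rays D1) (rays D2) F \<and>
      end_order_iso D1 D2 (f_ends D1) (f_ends D2) F"
    if "finite_out_degrees D1" "finite_out_degrees D2"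
    using quasi_isometry_compares_rays[OF wf_qi that] end_map_extends_on_rays[OF wf_qi that]
      end_comparison.end_map_order_iso by blast
  show "\<exists>F. extends_on_antirays \<gamma> c D1 D2 f (antirays D1) (antirays D2) F \<and>
      end_order_iso D1 D2 (b_ends D1) (b_ends D2) F"
    if "finite_in_degrees D1" "finite_in_degrees D2"
    using quasi_isometry_compares_antirays[OF wf_qi that] end_map_extends_on_antirays[OF wf_qi that]
      end_comparison.end_map_order_iso by blast
  show "\<exists>F. extends_on_rays \<gamma> c D1 D2 f (rays D1 \<union> antirays D1) (rays D2 \<union> antirays D2) F \<and>
      extends_on_antirays \<gamma> c D1 D2 f (rays D1 \<union> antirays D1) (rays D2 \<union> antirays D2) F \<and>
      end_order_iso D1 D2 (ends D1) (ends D2) F"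
    if lf: "locally_finite_digraph D1" "locally_finite_digraph D2"
  proof -
    have fin_out: "finite_out_degrees D1" "finite_out_degrees D2"
      and fin_in: "finite_in_degrees D1" "finite_in_degrees D2"
      using lf by (simp_all add: locally_finite_digraph_def)
    \<comment> \<open>Rays are compared with anti-rays here, which goes beyond the orders on f-ends and b-ends.\<close>
    have "ray_le D2 (f \<circ> R) (f \<circ> S) \<longleftrightarrow> ray_le D1 R S"
      if "R \<in> rays D1 \<union> antirays D1" "S \<in> rays D1 \<union> antirays D1" for R S
      using that ray_in_verts[OF wf_qi(1)] antiray_in_verts[OF wf_qi(1)]
      by (intro quasi_isometry_ray_le_iff[OF wf_qi fin_out]) auto
    then have "end_comparison D1 D2 (rays D1 \<union> antirays D1) (rays D2 \<union> antirays D2) f"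
      using quasi_isometry_compares_rays[OF wf_qi fin_out]
        quasi_isometry_compares_antirays[OF wf_qi fin_in] by (intro end_comparison_Un)
    then show ?thesis
      using end_map_extends_on_rays[OF wf_qi fin_out] end_map_extends_on_antirays[OF wf_qi fin_in]
        end_comparison.end_map_order_iso by blast
  qed
qed

end
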